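(* Let $n\ge1$ and $t_1\ne0$. Then $$zX_n(z)=a_nY_{-n-1}(z)+b_nX_n(z)+c_nY_{-n}(z)+d_nX_{n-1}(z)$$ with $$a_n=\frac{(1-t_1t_2q^n)(1-t_1t_3q^n)(1-t_1t_4q^n)\big(-1-t_1t_2+t_1t_2t_3t_4q^{n-1}+t_1t_2q^n\big)}{t_1(1-t_3t_4q^n)(1-t_1t_2t_3t_4q^{2n-1})(1-t_1t_2t_3t_4q^{2n})},$$ $$b_n=\frac{q^n\big(-1-t_1t_2+t_1t_2t_3t_4q^{n-1}+t_1t_2q^n\big)\big(-t_3-t_4+t_2t_3t_4q^n+t_1t_3t_4q^n\big)}{(1-t_1t_2t_3t_4q^{2n-1})(1-t_1t_2t_3t_4q^{2n})},$$ $$c_n=-\frac{(1-q^n)(1-t_1t_2q^n)\big(-t_1-t_2+t_1t_2(t_3+t_4)q^{n-1}\big)}{(1-t_1t_2t_3t_4q^{2n-2})(1-t_1t_2t_3t_4q^{2n-1})},$$ $$d_n=\frac{t_1(1-q^n)(1-t_1t_2q^n)(1-t_2t_3q^{n-1})(1-t_2t_4q^{n-1})(1-t_3t_4q^{n-1})}{(1-t_1t_2q^{n-1})(1-t_1t_2t_3t_4q^{2n-2})(1-t_1t_2t_3t_4q^{2n-1})}.$$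
   Context: Standing assumptions: $0<q<1$; $\mathbf t=(t_1,t_2,t_3,t_4)$ with each $t_i$ real and $|t_i|<1$. Notation: $(a;q)_k=\prod_{i=0}^{k-1}(1-aq^i)$, $(a_1,\dots,a_r;q)_k=\prod_j(a_j;q)_k$, and ${}_4\phi_3(a_1,a_2,a_3,a_4;b_1,b_2,b_3;q,q)=\sum_{k\ge 0}\frac{(a_1,a_2,a_3,a_4;q)_k}{(q,b_1,b_2,b_3;q)_k}q^k$. $R_n={}_4\phi_3(q^{-n},t_1t_2t_3t_4q^{n-1},t_1z,t_1/z;\;t_1t_2,t_1t_3,t_1t_4;q,q)$ for $n\ge0$; $S_0=0$ and for $n\ge1$, $S_n=z(1-t_3/z)(1-t_4/z)\;{}_4\phi_3(q^{1-n},t_1t_2t_3t_4q^{n},t_1z,qt_1/z;\;qt_1t_2,qt_1t_3,qt_1t_4;q,q)$. These are Laurent polynomials in $z$. Define the Laurent polynomials $X_{n}=(1-t_1t_2)(1-t_1t_3)(1-t_1t_4)R_n+t_1^2t_2(1-q^{n})S_n$ for $n\ge0$, $Y_{-n}=q^{n-1}t_3t_4(1-t_1t_2)(1-t_1t_3)(1-t_1t_4)R_n-t_1(1-t_1t_2t_3t_4q^{n-1})S_n$ for $n>0$. *)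

theory Defs
  imports Complex_Main
begin

text \<open>
  The parameters \<open>q\<close>, \<open>t1\<close>, \<open>t2\<close>, \<open>t3\<close>, \<open>t4\<close> are real. A Laurent polynomial in \<open>z\<close> is represented by
  the function that it induces on the nonzero complex numbers, which determines it.
\<close>

definition qpoch :: "complex \<Rightarrow> complex \<Rightarrow> nat \<Rightarrow> complex" where
  "qpoch a q k = (\<Prod>i<k. 1 - a * q ^ i)"

text \<open>The series has only finitely many nonzero terms if some \<open>a\<^sub>i\<close> is \<open>q\<close> to the power \<open>-m\<close>,
  \<open>m\<close> a natural number; this is the case in all uses below.\<close>

definition phi43 ::
  "complex \<Rightarrow> complex \<Rightarrow> complex \<Rightarrow> complex \<Rightarrow> complex \<Rightarrow> complex \<Rightarrow> complex \<Rightarrow> complex \<Rightarrow> complex"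
where
  "phi43 a1 a2 a3 a4 b1 b2 b3 q =
     (\<Sum>k. (qpoch a1 q k * qpoch a2 q k * qpoch a3 q k * qpoch a4 q k) /
           (qpoch q q k * qpoch b1 q k * qpoch b2 q k * qpoch b3 q k) * q ^ k)"

definition AW_R :: "real \<Rightarrow> real \<Rightarrow> real \<Rightarrow> real \<Rightarrow> real \<Rightarrow> nat \<Rightarrow> complex \<Rightarrow> complex" where
  "AW_R q t1 t2 t3 t4 n z =
     phi43 (of_real (q powi (- int n))) (of_real (t1 * t2 * t3 * t4 * q powi (int n - 1)))
       (of_real t1 * z) (of_real t1 / z)
       (of_real (t1 * t2)) (of_real (t1 * t3)) (of_real (t1 * t4)) (of_real q)"

definition AW_S :: "real \<Rightarrow> real \<Rightarrow> real \<Rightarrow> real \<Rightarrow> real \<Rightarrow> nat \<Rightarrow> complex \<Rightarrow> complex" where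
  "AW_S q t1 t2 t3 t4 n z =
     (if n = 0 then 0 else
      z * (1 - of_real t3 / z) * (1 - of_real t4 / z) *
      phi43 (of_real (q powi (1 - int n))) (of_real (t1 * t2 * t3 * t4 * q ^ n))
        (of_real t1 * z) (of_real (q * t1) / z)
        (of_real (q * t1 * t2)) (of_real (q * t1 * t3)) (of_real (q * t1 * t4)) (of_real q))"

definition AW_X :: "real \<Rightarrow> real \<Rightarrow> real \<Rightarrow> real \<Rightarrow> real \<Rightarrow> nat \<Rightarrow> complex \<Rightarrow> complex" where
  "AW_X q t1 t2 t3 t4 n z =
     of_real ((1 - t1 * t2) * (1 - t1 * t3) * (1 - t1 * t4)) * AW_R q t1 t2 t3 t4 n z +
     of_real (t1\<^sup>2 * t2 * (1 - q ^ n)) * AW_S q t1 t2 t3 t4 n z"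

text \<open>The index \<open>m\<close> of \<open>AW_Y\<close> is meant to be negative: \<open>m = - n\<close> with \<open>n > 0\<close>.\<close>

definition AW_Y :: "real \<Rightarrow> real \<Rightarrow> real \<Rightarrow> real \<Rightarrow> real \<Rightarrow> int \<Rightarrow> complex \<Rightarrow> complex" where
  "AW_Y q t1 t2 t3 t4 m z =
     (let n = nat (- m) in
      of_real (q ^ (n - 1) * t3 * t4 * (1 - t1 * t2) * (1 - t1 * t3) * (1 - t1 * t4)) *
        AW_R q t1 t2 t3 t4 n z -
      of_real (t1 * (1 - t1 * t2 * t3 * t4 * q ^ (n - 1))) * AW_S q t1 t2 t3 t4 n z)"

end

theory Submission
  imports Defs
begin

text \<open>
  Put \<open>\<sigma> = z + q / z\<close> and \<open>W\<^sub>j = (t\<^sub>1 z, q t\<^sub>1 / z; q)\<^sub>j\<close>, both invariant under \<open>z \<mapsto> q / z\<close>. Every Laurent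
  polynomial in the recurrence has the form \<open>A + z B\<close> with \<open>A\<close> and \<open>B\<close> linear combinations of
  the \<open>W\<^sub>j\<close>: the summands of \<open>R\<^sub>n\<close> and \<open>S\<^sub>n\<close> only involve \<open>W\<^sub>j\<close> and \<open>W\<^sub>j\<^sub>-\<^sub>1\<close>, since
  \<open>\<sigma> W\<^sub>j\<close> is a combination of \<open>W\<^sub>j\<close> and \<open>W\<^sub>j\<^sub>+\<^sub>1\<close>. For \<open>X\<^sub>n\<close> and \<open>Y\<^sub>-\<^sub>n\<close> the part \<open>B\<close> is a multiple
  of the series in \<open>S\<^sub>n\<close>, with a coefficient that factors completely. As \<open>z\<^sup>2 = \<sigma> z - q\<close>,
  comparing the parts \<open>A\<close> and \<open>B\<close> and the coefficients of \<open>W\<^sub>j\<close> reduces the recurrence to two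
  identities between hypergeometric terms, that is, to polynomial identities in \<open>t\<^sub>1\<close>, \<open>t\<^sub>2\<close>,
  \<open>t\<^sub>3 + t\<^sub>4\<close>, \<open>t\<^sub>3 t\<^sub>4\<close>, \<open>q\<close>, \<open>q\<^sup>n\<^sup>-\<^sup>1\<close> and \<open>q\<^sup>j\<close>.
\<close>

subsection \<open>Polynomial identities\<close>

text \<open>Here \<open>M\<close>, \<open>N\<close>, \<open>J\<close> stand for \<open>q\<^sup>n\<^sup>-\<^sup>1\<close>, \<open>q\<^sup>n\<close>, \<open>q\<^sup>j\<close>. Up to factors that cancel, \<open>s1\<close>, \<open>s0\<close>, \<open>s9\<close> are the
  coefficients of \<open>W\<^sub>j\<close> in the series of \<open>S\<^sub>n\<^sub>+\<^sub>1\<close>, \<open>S\<^sub>n\<close>, \<open>S\<^sub>n\<^sub>-\<^sub>1\<close>, and \<open>m1\<close>, \<open>m0\<close>, \<open>m9\<close> those of \<open>W\<^sub>j\<^sub>-\<^sub>1\<close>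
  divided by \<open>1 - J\<close>; the case \<open>j = 0\<close> is separate because one of these factors can be singular there.\<close>

lemma const_part_poly_Suc:
  fixes t1 t2 e1 e2 M J q :: "'a::field"
  assumes "N = q * M" "x = t1 * t2" "T = x * e2"
   "D0 = 1 - T*M^2" "D1 = 1 - T*M*N" "D2 = 1 - T*N^2"
   "E1 = 1 - e2*N" "E2 = 1 - x*M" "G = (1 - x*J)*(1 - t1*e1*J + t1^2*e2*J^2)"
   "k = -1 - x + T*M + x*N"
   "s1 = q*(q*N-J)*(q-T*M*J)*(1-T*M*J)*(1-T*N*J)" "m1 = q*N*G*(q-T*M*J)*(1-T*M*J)"
   "s0 = q*(q*N-J)*(N-J)*(q-T*M*J)*(1-T*M*J)" "m0 = N*G*(q*N-J)*(q-T*M*J)"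
   "s9 = q*(q*N-J)*(N-J)*(M-J)*(1-T*M)*(q-T*M*J)" "m9 = q*M*G*(q*N-J)*(N-J)*(1-T*M)"
   "br = (\<lambda>s m. s*(e2*(1+t1^2*J^2*q) - q*t1*J*e1) - q*e2*(1-J)*m)"
   "y1 = e2*(q*N-1)*(q*m1-s1) - br s1 m1" "x0 = q*(1-T*M)*(q*m0-s0) - N*x*br s0 m0"
   "y0 = e2*(N-1)*(q*m0-s0) - br s0 m0" "x9 = (q-T*M)*(q*m9-s9) - M*x*br s9 m9"
 shows "-(q^2*t1^2*J*(1-x*N)*s0*D0*D1*D2*E1*E2) =
   N*(1-x*N)*(1-t1*e1*N+t1^2*e2*N^2)*k*y1*D0*E2 +
   t1*N*k*(-e1+t2*e2*N+t1*e2*N)*x0*D0*E1*E2 +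
   t1*N*(1-x*N)*(-t1-t2+x*e1*M)*(1-T*M)*y0*D2*E1*E2
   - q*t1^2*(1-x*N)*(1-t2*e1*M+t2^2*e2*M^2)*(1-e2*M)*x9*D2*E1"
  unfolding assms
  by algebra

text \<open>On the right only the plain series coefficients \<open>s1\<close>, \<open>s0\<close>,
  \<open>s9\<close> occur, because the \<open>z\<close>-part of each X and Y is a multiple of its
  series. Those multiples contain \<open>1 - e2*N\<close> and \<open>1 - x*M\<close>, which cancel
  the matching denominators of the recurrence coefficients.\<close>

lemma z_part_poly_Suc:
  fixes t1 t2 e1 e2 M J q :: "'a::field"
  assumes "N = q * M" "x = t1 * t2" "T = x * e2"
   "D0 = 1 - T*M^2" "D1 = 1 - T*M*N" "D2 = 1 - T*N^2"
   "G = (1 - x*J)*(1 - t1*e1*J + t1^2*e2*J^2)"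
   "k = -1 - x + T*M + x*N"
   "s1 = q*(q*N-J)*(q-T*M*J)*(1-T*M*J)*(1-T*N*J)"
   "s0 = q*(q*N-J)*(N-J)*(q-T*M*J)*(1-T*M*J)" "m0 = N*G*(q*N-J)*(q-T*M*J)"
   "s9 = q*(q*N-J)*(N-J)*(M-J)*(1-T*M)*(q-T*M*J)"
   "br = (\<lambda>s m. s*(e2*(1+t1^2*J^2*q) - q*t1*J*e1) - q*e2*(1-J)*m)"
   "x0 = q*(1-T*M)*(q*m0-s0) - N*x*br s0 m0"
 shows "(x0 + q*(1-x*N)*(s0*(1+t1^2*J^2*q) - q*(1-J)*m0))*D0*D1*D2 =
   - (q*J*N*(1-x*N)*(1-t1*e1*N+t1^2*e2*N^2)*k*s1*D0)
   + q*J*N*t1*k*(-e1+t2*e2*N+t1*e2*N)*(1-x*N)*s0*D0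
   - q*J*N*t1*(1-x*N)*(-t1-t2+x*e1*M)*(1-T*M)*(1-e2*M)*s0*D2
   - q^2*J*t1^2*(1-x*N)*(1-t2*e1*M+t2^2*e2*M^2)*(1-e2*M)*s9*D2"
  unfolding assms
  by algebra

text \<open>At index 0 every series has coefficient 1 and no preceding coefficient, so the bracket
  \<open>br\<close> shrinks to \<open>b\<close>; \<open>G\<close> at \<open>J = 1\<close> is the
  normalizing factor of X and Y.\<close>

lemma const_part_poly_0:
  fixes t1 t2 e1 e2 M q :: "'a::field"
  assumes "N = q * M" "x = t1 * t2" "T = x * e2"
   "D0 = 1 - T*M^2" "D1 = 1 - T*M*N" "D2 = 1 - T*N^2"
   "E1 = 1 - e2*N" "E2 = 1 - x*M" "G = (1 - x)*(1 - t1*e1 + t1^2*e2)"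
   "k = -1 - x + T*M + x*N" "b = e2*(1+t1^2*q) - q*t1*e1"
   "y1 = q*N*e2*G - e2*(q*N-1)*(1-T*N) - (1-T*N)*b"
   "x0 = q*N*G - q*(N-1)*(1-T*M) + N*x*(1-N)*b"
   "y0 = N*e2*G - e2*(N-1)*(1-T*M) - (1-T*M)*b"
   "x9 = N*G - (M-1)*(q-T*M) + M*x*(1-M)*b"
 shows "q^2*t1^2*(1-N)*(1-x*N)*D0*D1*D2*E1*E2 =
   N*(1-x*N)*(1-t1*e1*N+t1^2*e2*N^2)*k*y1*D0*E2 +
   t1*N*k*(-e1+t2*e2*N+t1*e2*N)*x0*D0*E1*E2 -
   t1*N*(1-N)*(1-x*N)*(-t1-t2+x*e1*M)*y0*D2*E1*E2
   + q*t1^2*(1-N)*(1-x*N)*(1-t2*e1*M+t2^2*e2*M^2)*(1-e2*M)*x9*D2*E1"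
  unfolding assms
  by algebra

lemma z_part_poly_0:
  fixes t1 t2 e1 e2 M q :: "'a::field"
  assumes "N = q * M" "x = t1 * t2" "T = x * e2"
   "D0 = 1 - T*M^2" "D1 = 1 - T*M*N" "D2 = 1 - T*N^2"
   "G = (1 - x)*(1 - t1*e1 + t1^2*e2)"
   "k = -1 - x + T*M + x*N" "b = e2*(1+t1^2*q) - q*t1*e1"
   "x0 = q*N*G - q*(N-1)*(1-T*M) + N*x*(1-N)*b"
 shows "(x0 - q*(1-N)*(1-x*N)*(1+t1^2*q))*D0*D1*D2 =
   - (q*N*(1-x*N)*(1-t1*e1*N+t1^2*e2*N^2)*k*(1-T*N)*D0)
   - q*N*t1*k*(-e1+t2*e2*N+t1*e2*N)*(1-N)*(1-x*N)*D0
   + q*N*t1*(1-N)*(1-x*N)*(-t1-t2+x*e1*M)*(1-T*M)*(1-e2*M)*D2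
   + q^2*t1^2*(1-N)*(1-x*N)*(1-t2*e1*M+t2^2*e2*M^2)*(1-e2*M)*(M-1)*D2"
  unfolding assms
  by algebra

subsection \<open>Expansions in the symmetric basis\<close>

lemma qpoch_0 [simp]: "qpoch a q 0 = 1"
  by (simp add: qpoch_def)

lemma qpoch_Suc: "qpoch a q (Suc k) = qpoch a q k * (1 - a * q ^ k)"
  by (simp add: qpoch_def)

lemma qpoch_Suc_shift: "qpoch a q (Suc k) = (1 - a) * qpoch (q * a) q k"
  unfolding qpoch_def by (subst prod.lessThan_Suc_shift) (simp add: mult.assoc mult.left_commute)

lemma qpoch_eq_0:
  assumes "q \<noteq> 0" "m < k"
  shows "qpoch (inverse q ^ m) q k = 0"
  using assms by (auto simp: qpoch_def power_inverse intro!: bexI[of _ m])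

lemma qpoch_nonzero: "(\<And>k. 1 - a * q ^ k \<noteq> 0) \<Longrightarrow> qpoch a q k \<noteq> 0"
  by (simp add: qpoch_def)

text \<open>Multiplication by \<open>z + q / z\<close> feeds the coefficient of
  \<open>W (j - 1)\<close> into that of \<open>W j\<close>; the value 0 makes \<open>j = 0\<close>
  fit the same formula.\<close>

definition prev :: "(nat \<Rightarrow> complex) \<Rightarrow> nat \<Rightarrow> complex" where
  "prev f j = (case j of 0 \<Rightarrow> 0 | Suc i \<Rightarrow> f i)"

lemma prev_simps [simp]: "prev f 0 = 0" "prev f (Suc i) = f i"
  by (simp_all add: prev_def)

text \<open>The parameters are complex and restricted only by the nonvanishing of quantities that
  are divided by; the hypotheses of the theorem supply all of these.\<close>

locale askey_wilson =
  fixes q t1 t2 t3 t4 z :: complex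
  assumes q_nonzero: "q \<noteq> 0" and t1_nonzero: "t1 \<noteq> 0" and z_nonzero: "z \<noteq> 0"
    and q_power: "1 - q ^ Suc k \<noteq> 0"
    and t12: "1 - t1 * t2 * q ^ k \<noteq> 0"
    and t13: "1 - t1 * t3 * q ^ k \<noteq> 0"
    and t14: "1 - t1 * t4 * q ^ k \<noteq> 0"
    and t34: "1 - t3 * t4 * q ^ k \<noteq> 0"
    and t1234: "1 - t1 * t2 * t3 * t4 * q ^ k \<noteq> 0"
begin

definition "T = t1 * t2 * t3 * t4"
definition "P = (1 - t1 * t2) * (1 - t1 * t3) * (1 - t1 * t4)"
definition "e1 = t3 + t4"
definition "e2 = t3 * t4"
definition "W k = qpoch (t1 * z) q k * qpoch (q * t1 / z) q k"
text \<open>\<open>U\<close> is the basis in which \<open>R\<close> is given, symmetric under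
  \<open>z -> 1 / z\<close>, whereas \<open>W\<close> is symmetric under
  \<open>z -> q / z\<close>.\<close>

definition "U k = qpoch (t1 * z) q k * qpoch (t1 / z) q k"
definition "r m k = qpoch (inverse q ^ m) q k * qpoch (T * q ^ m / q) q k /
  (qpoch q q k * qpoch (t1 * t2) q k * qpoch (t1 * t3) q k * qpoch (t1 * t4) q k) * q ^ k"
definition "d k = qpoch q q k * qpoch (q * t1 * t2) q k * qpoch (q * t1 * t3) q k * qpoch (q * t1 * t4) q k"
definition "s m k = qpoch (q * inverse q ^ m) q k * qpoch (T * q ^ m) q k / d k * q ^ k"
text \<open>Up to sign the eigenvalue of the Askey-Wilson operator at degree \<open>m\<close>; here
  it consists of the leading factors split off the numerator of \<open>r m (Suc j)\<close>.\<close>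

definition "h m = (1 - inverse q ^ m) * (1 - T * q ^ m / q)"
definition "R m = (\<Sum>k. r m k * U k)"
definition "\<phi> m = (\<Sum>k. s m k * W k)"
definition "S m = (z - e1 + e2 / z) * \<phi> m"

lemma qpoch_q: "qpoch q q k \<noteq> 0"
  using q_power by (intro qpoch_nonzero) simp

lemma qpoch_t:
  "qpoch (t1 * t2) q k \<noteq> 0" "qpoch (t1 * t3) q k \<noteq> 0" "qpoch (t1 * t4) q k \<noteq> 0"
  "qpoch (q * t1 * t2) q k \<noteq> 0" "qpoch (q * t1 * t3) q k \<noteq> 0" "qpoch (q * t1 * t4) q k \<noteq> 0"
  using t12 t13 t14 t12[of "Suc _"] t13[of "Suc _"] t14[of "Suc _"]
  by (auto intro!: qpoch_nonzero simp: mult_ac)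

lemma d_nonzero: "d k \<noteq> 0"
  by (simp add: d_def qpoch_q qpoch_t)

lemma d_Suc: "d (Suc k) = d k * (1 - q ^ Suc k) * (1 - t1 * t2 * q ^ Suc k) *
    (1 - t1 * t3 * q ^ Suc k) * (1 - t1 * t4 * q ^ Suc k)"
  by (simp add: d_def qpoch_Suc mult_ac)

lemma t_nonzero: "1 - t1 * t2 \<noteq> 0" "1 - t1 * t3 \<noteq> 0" "1 - t1 * t4 \<noteq> 0"
  using t12[of 0] t13[of 0] t14[of 0] by simp_all

text \<open>Splitting the first factor off every Pochhammer symbol except \<open>qpoch q q\<close>
  turns the parameters of \<open>R\<close> into those of \<open>S\<close>. The factor
  \<open>1 - q ^ Suc j\<close> is kept because \<open>U_Suc_W\<close> produces it.\<close>

lemma r_Suc: "P * r m (Suc j) * (1 - q ^ Suc j) = q * h m * s m j"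
proof -
  have *: "qpoch (t1*t2) q (Suc j) = (1-t1*t2) * qpoch (q*t1*t2) q j" for t1 t2
    by (simp add: qpoch_Suc_shift mult.assoc)
  have **: "qpoch (T * q ^ m / q) q (Suc j) = (1 - T*q^m/q) * qpoch (T * q ^ m) q j"
    using q_nonzero by (simp add: qpoch_Suc_shift)
  have "1 - q * q ^ j \<noteq> 0"
    using q_power[of j] by simp
  moreover have "qpoch q q (Suc j) = qpoch q q j * (1 - q * q^j)"
    by (simp add: qpoch_Suc)
  ultimately show ?thesis
    unfolding r_def s_def P_def h_def d_def * ** qpoch_Suc_shift[of "inverse q ^ m"]
    using t_nonzero qpoch_t qpoch_q by (simp add: divide_simps)
qed

lemma r_0 [simp]: "r m 0 = 1" and s_0 [simp]: "s m 0 = 1" and W_0 [simp]: "W 0 = 1"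
  by (simp_all add: r_def s_def d_def W_def)

lemma W_Suc: "W (Suc k) = W k * (1 + t1\<^sup>2 * (q^k)\<^sup>2 * q - t1 * q ^ k * (z + q / z))"
  using z_nonzero by (simp add: W_def qpoch_Suc field_simps power2_eq_square)

lemma U_0 [simp]: "U 0 = 1"
  by (simp add: U_def)

lemma U_Suc: "U (Suc k) = W k * (1 - t1 / z) * (1 - t1 * z * q ^ k)"
  unfolding U_def W_def qpoch_Suc[of "t1 * z"] qpoch_Suc_shift[of "t1 / z"] by (simp add: mult_ac)

text \<open>Subtracting \<open>W (Suc k) / q ^ Suc k\<close> cancels the term in
  \<open>1 / z\<close>; what remains is \<open>W k\<close> times a linear polynomial in
  \<open>z\<close> divisible by \<open>1 - q ^ Suc k\<close>.\<close>

lemma U_Suc_W: "U (Suc k) = (W (Suc k) - (1 - q ^ Suc k) * W k) / q ^ Suc k + z * t1 / q * (1 - q ^ Suc k) * W k"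
  unfolding U_Suc W_Suc using z_nonzero q_nonzero by (simp add: field_simps power2_eq_square)

text \<open>\<open>U_Suc_W\<close> moves a part of summand \<open>k + 1\<close> down to
  \<open>W k\<close>, and by \<open>r_Suc\<close> its coefficient involves
  \<open>h m * s m k\<close>. The boundary term corrects for the missing summand after the last one;
  it vanishes if \<open>s m L = 0\<close> or \<open>h m = 0\<close>.\<close>

lemma sum_r_U: "(\<Sum>k\<le>L. P * r m k * U k) =
   (\<Sum>j\<le>L. (P * r m j - h m * s m j) / q ^ j * W j) + z * t1 * h m * (\<Sum>j\<le>L. s m j * W j)
   + h m * s m L * W L * (1 / q ^ L - z * t1)"
proof (induction L)
  case 0
  then show ?case by (simp add: algebra_simps)
next
  case (Suc L)
  have "P * r m (Suc L) * U (Suc L) = P * r m (Suc L) * W (Suc L) / q ^ Suc L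
     + (P * r m (Suc L) * (1 - q ^ Suc L)) * W L * (z * t1 / q - 1 / q ^ Suc L)"
    unfolding U_Suc_W using q_nonzero by (simp add: field_simps)
  also have "\<dots> = P * r m (Suc L) * W (Suc L) / q ^ Suc L
     + h m * s m L * W L * (z * t1 - 1 / q ^ L)"
    unfolding r_Suc using q_nonzero by (simp add: field_simps)
  finally show ?case
    unfolding sum.atMost_Suc Suc.IH
    by (simp add: algebra_simps diff_divide_distrib)
qed

text \<open>This is \<open>W_Suc\<close> solved for \<open>W j * (z + q / z)\<close> and summed; the
  boundary term is what is left over at \<open>W (Suc L)\<close>.\<close>

lemma sum_s_sigma_W: "(\<Sum>j\<le>L. f j * W j) * (z + q / z) =
   (\<Sum>j\<le>L. (f j * (1 + t1\<^sup>2 * (q^j)\<^sup>2 * q) - q * prev f j) / (t1 * q ^ j) * W j)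
   - f L * W (Suc L) / (t1 * q ^ L)"
proof (induction L)
  case 0
  then show ?case using t1_nonzero z_nonzero by (simp add: W_Suc field_simps)
next
  case (Suc L)
  have "f (Suc L) * W (Suc L) * (z + q/z) =
    (f (Suc L) * (1 + t1\<^sup>2 * (q^Suc L)\<^sup>2 * q)) / (t1 * q ^ Suc L) * W (Suc L)
     - f (Suc L) * W (Suc (Suc L)) / (t1 * q ^ Suc L)"
    unfolding W_Suc[of "Suc L"] using t1_nonzero q_nonzero z_nonzero by (simp add: field_simps)
  moreover have "f L * W (Suc L) / (t1 * q ^ L) = q * f L / (t1 * q ^ Suc L) * W (Suc L)"
    using t1_nonzero q_nonzero by (simp add: field_simps)
  ultimately show ?case
    unfolding sum.atMost_Suc distrib_right Suc.IH prev_simps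
    by (simp add: algebra_simps diff_divide_distrib add_divide_distrib)
qed

section \<open>Termination of the series and splitting into two parts\<close>

lemma r_eq_0: "m < k \<Longrightarrow> r m k = 0"
  using qpoch_eq_0[OF q_nonzero] by (simp add: r_def)

text \<open>The first numerator parameter is \<open>q\<close> to the power \<open>1 - m\<close>,
  which forces termination only from \<open>m = 1\<close> on.\<close>

lemma s_eq_0:
  assumes "m \<ge> 1" "m \<le> k"
  shows "s m k = 0"
proof -
  have "q * inverse q ^ m = inverse q ^ (m - 1)"
    using assms(1) q_nonzero by (cases m) auto
  then show ?thesis
    using qpoch_eq_0[OF q_nonzero, of "m - 1" k] assms by (simp add: s_def)
qed

lemma R_eq: "m \<le> L \<Longrightarrow> R m = (\<Sum>k\<le>L. r m k * U k)"
  unfolding R_def by (rule suminf_finite) (auto simp: r_eq_0)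

lemma phi_eq: "1 \<le> m \<Longrightarrow> m \<le> L \<Longrightarrow> \<phi> m = (\<Sum>k\<le>L. s m k * W k)"
  unfolding \<phi>_def by (rule suminf_finite) (auto simp: s_eq_0)

text \<open>The coefficient of \<open>W\<^sub>j\<close> in the part of \<open>\<mu> P R\<^sub>m + \<nu> S\<^sub>m\<close> without the factor \<open>z\<close>.\<close>

definition rho :: "complex \<Rightarrow> complex \<Rightarrow> nat \<Rightarrow> nat \<Rightarrow> complex" where
  "rho \<mu> \<nu> m j = (q * t1 * \<mu> * (P * r m j - h m * s m j)
     + \<nu> * (s m j * (e2 * (1 + t1\<^sup>2 * (q^j)\<^sup>2 * q) - q * t1 * q ^ j * e1) - q * e2 * prev (s m) j)) / (q * t1 * q ^ j)"

text \<open>The prefactor of \<open>S m\<close> is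
  \<open>z * (1 - e2 / q) + e2 / q * (z + q / z) - e1\<close>, whose symmetric middle term expands
  by \<open>sum_s_sigma_W\<close>; \<open>R m\<close> splits by \<open>sum_r_U\<close>.\<close>

lemma rho_expansion:
  assumes "1 \<le> m" "m \<le> L"
  shows "\<mu> * P * R m + \<nu> * S m =
    (\<Sum>j\<le>L. rho \<mu> \<nu> m j * W j) + z * (\<mu> * t1 * h m + \<nu> * (1 - e2 / q)) * \<phi> m"
proof -
  define g where "g j = (s m j * (1 + t1\<^sup>2 * (q^j)\<^sup>2 * q) - q * prev (s m) j) / (t1 * q ^ j)" for j
  have sL: "s m L = 0" using assms by (rule s_eq_0)
  have "\<mu> * P * R m = \<mu> * (\<Sum>k\<le>L. P * r m k * U k)"
    by (simp add: R_eq[OF assms(2)] sum_distrib_left mult_ac)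
  also have "\<dots> = (\<Sum>j\<le>L. \<mu> * ((P * r m j - h m * s m j) / q ^ j) * W j) + z * \<mu> * t1 * h m * \<phi> m"
    unfolding sum_r_U by (simp add: sL phi_eq[OF assms] distrib_left sum_distrib_left mult_ac)
  finally have 1: "\<mu> * P * R m = \<dots>" .
  have "S m = z * (1 - e2/q) * \<phi> m + e2 / q * (\<phi> m * (z + q / z)) - e1 * \<phi> m"
    using q_nonzero z_nonzero by (simp add: S_def field_simps)
  also have "\<phi> m * (z + q / z) =
     (\<Sum>j\<le>L. (s m j * (1 + t1\<^sup>2 * (q^j)\<^sup>2 * q) - q * prev (s m) j) / (t1 * q ^ j) * W j)"
    unfolding phi_eq[OF assms] sum_s_sigma_W by (simp add: sL)
  finally have "\<nu> * S m = \<nu> * (z * (1 - e2/q) * \<phi> m + e2 / q * (\<Sum>j\<le>L. g j * W j) - e1 * \<phi> m)"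
    by (simp add: g_def)
  also have "e1 * \<phi> m = (\<Sum>j\<le>L. e1 * s m j * W j)"
    by (simp add: phi_eq[OF assms] sum_distrib_left mult_ac)
  finally have 2: "\<nu> * S m = \<nu> * z * (1 - e2/q) * \<phi> m + (\<Sum>j\<le>L. \<nu> * (e2 / q * g j - e1 * s m j) * W j)"
    by (simp add: sum_distrib_left sum_subtractf algebra_simps)
  have 3: "rho \<mu> \<nu> m j = \<mu> * ((P * r m j - h m * s m j) / q ^ j) +
     \<nu> * (e2 / q * g j - e1 * s m j)" for j
    unfolding rho_def g_def using q_nonzero t1_nonzero by (simp add: field_simps)
  show ?thesis
    unfolding 1 2 3 distrib_right sum.distrib by (simp add: algebra_simps)
qed

text \<open>Needed for degree \<open>n - 1 = 0\<close>: the coefficients \<open>s 0\<close> are not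
  covered by \<open>s_eq_0\<close>, but \<open>h 0 = 0\<close> removes them and the boundary
  term.\<close>

lemma rho_expansion_0:
  fixes L :: nat
  shows "\<mu> * P * R 0 = (\<Sum>j\<le>L. rho \<mu> 0 0 j * W j)"
proof -
  have h: "h 0 = 0" by (simp add: h_def)
  have "\<mu> * P * R 0 = \<mu> * (\<Sum>k\<le>L. P * r 0 k * U k)"
    by (simp add: R_eq[of 0 L] sum_distrib_left mult_ac)
  also have "\<dots> = (\<Sum>j\<le>L. \<mu> * (P * r 0 j / q ^ j) * W j)"
    unfolding sum_r_U by (simp add: h sum_distrib_left mult_ac)
  also have "\<dots> = (\<Sum>j\<le>L. rho \<mu> 0 0 j * W j)"
    unfolding rho_def using q_nonzero t1_nonzero by (simp add: h)
  finally show ?thesis .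
qed

section \<open>Series coefficients of neighbouring degrees over a common factor\<close>

text \<open>The factor \<open>M - 1\<close> in the values for \<open>n - 1\<close> allows for \<open>n = 1\<close>, where the series in \<open>S\<^sub>0\<close> does not
  terminate but only enters the recurrence with coefficient \<open>0\<close>.\<close>

lemma values_Suc:
  assumes "n \<ge> 1"
    and N: "N = q ^ n" and M: "M = q ^ (n - 1)" and J: "J = q ^ Suc i"
    and G: "G = (1 - t1*t2*J) * (1 - t1*t3*J) * (1 - t1*t4*J)"
  obtains B where
    "s (Suc n) (Suc i) = B*(N-1)*(q*(q*N-J)*(q-T*M*J)*(1-T*M*J)*(1-T*N*J))"
    "s (Suc n) i = (1-J)*B*(N-1)*(q*N*G*(q-T*M*J)*(1-T*M*J))"
    "s n (Suc i) = B*(1-T*N)*(q*(q*N-J)*(N-J)*(q-T*M*J)*(1-T*M*J))"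
    "s n i = (1-J)*B*(1-T*N)*(N*G*(q*N-J)*(q-T*M*J))"
    "(M-1)*s (n-1) (Suc i) = B*(1-T*N)*(q*(q*N-J)*(N-J)*(M-J)*(1-T*M)*(q-T*M*J))"
    "(M-1)*s (n-1) i = (1-J)*B*(1-T*N)*(q*M*G*(q*N-J)*(N-J)*(1-T*M))"
proof -
  have NM: "N = q * M" using assms by (cases n) auto
  have nz: "N \<noteq> 0" "M \<noteq> 0" "q \<noteq> 0" using q_nonzero by (auto simp: N M)
  have N1: "N - 1 \<noteq> 0" using q_power[of "n - 1"] assms by (auto simp: N)
  have TN: "1 - T * N \<noteq> 0" "1 - T * M \<noteq> 0" using t1234[of n] t1234[of "n-1"] by (auto simp: N M T_def)
  define I where "I = q ^ i"
  have JI: "J = q * I" by (simp add: J I_def)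
  define \<beta> where "\<beta> = qpoch (1 / N) q i"
  define \<theta> where "\<theta> = qpoch (T * M) q i"
  have iq: "inverse q ^ n = 1 / N" by (simp add: N power_inverse divide_inverse)
  \<comment> \<open>Splitting the last or the first factor off the same Pochhammer symbol relates
    base \<open>a\<close> to base \<open>q * a\<close>; this reduces all symbols to
    \<open>\<beta>\<close> and \<open>\<theta>\<close>.\<close>
  have b1: "qpoch (q / N) q i * (1 - 1 / N) = \<beta> * (1 - I / N)"
    using qpoch_Suc[of "1/N" q i] qpoch_Suc_shift[of "1/N" q i] by (simp add: \<beta>_def I_def mult.commute)
  have b2: "qpoch (q * (q / N)) q i * (1 - q / N) = qpoch (q / N) q i * (1 - q * I / N)"
    using qpoch_Suc[of "q/N" q i] qpoch_Suc_shift[of "q/N" q i] by (simp add: I_def mult.commute)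
  have th1: "qpoch (T * N) q i * (1 - T * M) = \<theta> * (1 - T * M * I)"
    using qpoch_Suc[of "T*M" q i] qpoch_Suc_shift[of "T*M" q i] by (simp add: \<theta>_def NM I_def mult_ac)
  have th2: "qpoch (q * T * N) q i * (1 - T * N) = qpoch (T * N) q i * (1 - T * N * I)"
    using qpoch_Suc[of "T*N" q i] qpoch_Suc_shift[of "T*N" q i] by (simp add: I_def mult_ac)
  have b1': "qpoch (q / N) q i = \<beta> * (N - I) / (N - 1)"
    using b1 nz N1 by (simp add: field_simps)
  \<comment> \<open>For \<open>n = 1\<close> the factor \<open>1 - q / N\<close> of
    \<open>b2\<close> is 0, so instead of dividing by it, \<open>M - 1\<close> stays on the
    left.\<close>
  have b2': "(M - 1) * qpoch (q * (q / N)) q i = \<beta> * (N - I) / (N - 1) * (M - I)"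
  proof -
    have "q / N = 1 / M" "q * I / N = I / M"
      using nz by (simp_all add: NM)
    then have "(M - 1) * qpoch (q * (q / N)) q i = M * (qpoch (q * (q / N)) q i * (1 - q / N))"
      using nz by (simp add: field_simps)
    also have "\<dots> = \<beta> * (N - I) / (N - 1) * (M * (1 - I / M))"
      unfolding b2 b1' using \<open>q * I / N = I / M\<close> by simp
    also have "M * (1 - I / M) = M - I"
      using nz by (simp add: field_simps)
    finally show ?thesis .
  qed
  have th1': "qpoch (T * N) q i = \<theta> * (1 - T * M * I) / (1 - T * M)"
    using th1 TN by (simp add: field_simps)
  have th2': "qpoch (q * T * N) q i = \<theta> * (1 - T * M * I) / (1 - T * M) * (1 - T * N * I) / (1 - T * N)"
    by (simp only: nonzero_eq_divide_eq[OF TN(1)] th2 th1')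
  have dS: "d (Suc i) = d i * (1 - J) * G"
    by (simp add: d_Suc J G mult_ac)
  have dnz: "d i \<noteq> 0" "1 - J \<noteq> 0" "G \<noteq> 0"
    using d_nonzero[of i] d_nonzero[of "Suc i"] unfolding dS by auto
  have sp: "s (Suc n) k = qpoch (1 / N) q k * qpoch (q * T * N) q k / d k * q ^ k" for k
  proof -
    have "q * inverse q ^ Suc n = 1 / N" "T * q ^ Suc n = q * T * N"
      using nz by (simp_all add: iq N)
    then show ?thesis by (simp only: s_def)
  qed
  have s0: "s n k = qpoch (q / N) q k * qpoch (T * N) q k / d k * q ^ k" for k
    by (simp add: s_def iq N power_inverse divide_inverse)
  have s9: "s (n-1) k = qpoch (q * (q / N)) q k * qpoch (T * M) q k / d k * q ^ k" for k
  proof -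
    have "q * inverse q ^ (n - 1) = q * (q / N)" "T * q ^ (n - 1) = T * M"
      unfolding power_inverse M[symmetric] NM using nz by (simp_all add: field_simps)
    then show ?thesis by (simp only: s_def)
  qed
  define D where "D = d i * (1 - J) * G"
  have D: "D \<noteq> 0" "d i = D / ((1 - J) * G)" "d (Suc i) = D"
    using dnz by (simp_all add: D_def dS)
  have IJ: "I = J / q" using nz by (simp add: JI)
  \<comment> \<open>\<open>B\<close> collects what the six values share, with denominators chosen so
    that the cofactors are polynomials.\<close>
  define B where "B = \<beta> * \<theta> * I / ((1 - T*M) * (1 - T*N) * q\<^sup>2 * N * (N-1) * D)"
  have S: "qpoch a q (Suc i) = qpoch a q i * (1 - a * I)" for a
    by (simp add: qpoch_Suc I_def)
  have QI: "q ^ i = I" "q ^ Suc i = J"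
    by (simp_all add: I_def J)
  have lin: "N - I = (q*N-J) / q" "1 - q / N * I = (N-J) / N" "M - I = (N-J) / q"
    "1 - 1 / N * I = (q*N-J) / (q*N)"
    "1 - q * (q / N) * I = (M-J) / M" "1 - T*M*I = (q-T*M*J) / q" "1 - T*N*I = 1 - T*M*J" "1 - q*T*N*I = 1 - T*N*J"
    using nz by (simp_all add: IJ NM field_simps)
  \<comment> \<open>Each linear factor becomes an atom, so that clearing denominators does not
    multiply the products out.\<close>
  define u v y f g l a b c where atoms: "u = q*N-J" "v = N-J" "y = M-J" "f = q-T*M*J" "g = 1-T*M*J"
    "l = 1-T*N*J" "a = 1-T*M" "b = 1-T*N" "c = 1-J"
  define e where "e = N - 1"
  note folds = atoms[symmetric] e_def[symmetric]
  note nonzero = nz N1[unfolded folds] TN[unfolded folds] dnz(2)[unfolded folds] dnz(3) D(1)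
  show thesis
  proof (rule that[of B])
    show "s (Suc n) (Suc i) = B*(N-1)*(q*(q*N-J)*(q-T*M*J)*(1-T*M*J)*(1-T*N*J))"
      unfolding sp S \<beta>_def[symmetric] th2' D QI B_def lin unfolding IJ folds using nonzero
      by (simp add: divide_simps power2_eq_square)
    show "s (Suc n) i = (1-J)*B*(N-1)*(q*N*G*(q-T*M*J)*(1-T*M*J))"
      unfolding sp \<beta>_def[symmetric] th2' D QI B_def lin unfolding IJ folds using nonzero
      by (simp add: divide_simps power2_eq_square)
    show "s n (Suc i) = B*(1-T*N)*(q*(q*N-J)*(N-J)*(q-T*M*J)*(1-T*M*J))"
      unfolding s0 S b1' th1' D QI B_def lin unfolding IJ folds using nonzero
      by (simp add: divide_simps power2_eq_square)
    show "s n i = (1-J)*B*(1-T*N)*(N*G*(q*N-J)*(q-T*M*J))"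
      unfolding s0 b1' th1' D QI B_def lin unfolding IJ folds using nonzero
      by (simp add: divide_simps power2_eq_square)
    have "(M-1)*s (n-1) (Suc i) = ((M - 1) * qpoch (q * (q / N)) q i) * (1 - q * (q / N) * I) * (\<theta> * (1 - T*M*I)) / D * J"
      unfolding s9 S D QI \<theta>_def by simp
    also have "\<dots> = B*(1-T*N)*(q*(q*N-J)*(N-J)*(M-J)*(1-T*M)*(q-T*M*J))"
      unfolding b2' B_def lin unfolding IJ folds using nonzero NM
      by (simp add: divide_simps power2_eq_square)
    finally show "(M-1)*s (n-1) (Suc i) = B*(1-T*N)*(q*(q*N-J)*(N-J)*(M-J)*(1-T*M)*(q-T*M*J))" .
    have "(M-1)*s (n-1) i = ((M - 1) * qpoch (q * (q / N)) q i) * \<theta> / d i * I"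
      unfolding s9 QI \<theta>_def by simp
    also have "\<dots> = (1-J)*B*(1-T*N)*(q*M*G*(q*N-J)*(N-J)*(1-T*M))"
      unfolding b2' B_def D lin unfolding IJ folds using nonzero NM
      by (simp add: divide_simps power2_eq_square)
    finally show "(M-1)*s (n-1) i = (1-J)*B*(1-T*N)*(q*M*G*(q*N-J)*(N-J)*(1-T*M))" .
  qed
qed

end

subsection \<open>The recurrence\<close>

lemma clear_denominators_const:
  fixes q t1 J M N D0 D1 D2 E1 E2 :: "'a::field"
  assumes "q \<noteq> 0" "t1 \<noteq> 0" "J \<noteq> 0" "M \<noteq> 0" "D0 \<noteq> 0" "D1 \<noteq> 0" "D2 \<noteq> 0" "E1 \<noteq> 0" "E2 \<noteq> 0"
    and "N = q * M"
    and poly: "q^2*t1^2*J*w*s0*D0*D1*D2*E1*E2 =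
      N*an*Y1*D0*E2 + t1*bn*X0*D0*E1*E2 + t1*N*cn*Y0*D2*E1*E2 + t1*q*dn*X9*D2*E1"
  shows "q*t1*w/N*s0 = an/(t1*E1*D1*D2)*(Y1/(q*J)) + bn/(D1*D2)*(X0/(N*q*J))
    + cn/(D0*D1)*(Y0/(q*J)) + dn/(E2*D0*D1)*(X9/(M*q*J))"
proof -
  let ?K = "N*q*t1*J*D0*D1*D2*E1*E2"
  have "an/(t1*E1*D1*D2)*(Y1/(q*J)) = N*an*Y1*D0*E2/?K"
    "bn/(D1*D2)*(X0/(N*q*J)) = t1*bn*X0*D0*E1*E2/?K"
    "cn/(D0*D1)*(Y0/(q*J)) = t1*N*cn*Y0*D2*E1*E2/?K"
    "dn/(E2*D0*D1)*(X9/(M*q*J)) = t1*q*dn*X9*D2*E1/?K"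
    "q*t1*w/N*s0 = q^2*t1^2*J*w*s0*D0*D1*D2*E1*E2/?K"
    using assms(1-9) unfolding \<open>N = q * M\<close> by (simp_all add: power2_eq_square)
  then show ?thesis
    by (simp only: poly add_divide_distrib)
qed

text \<open>\<open>s9\<close> enters only through its product with \<open>M - 1\<close>, the
  quantity that \<open>values_Suc\<close> provides. \<open>E1\<close> and \<open>E2\<close> cancel
  within single terms and are absent from \<open>?K\<close>.\<close>

lemma clear_denominators_z:
  fixes q t1 J M N D0 D1 D2 E1 E2 :: "'a::field"
  assumes "q \<noteq> 0" "t1 \<noteq> 0" "J \<noteq> 0" "M \<noteq> 0" "D0 \<noteq> 0" "D1 \<noteq> 0" "D2 \<noteq> 0" "E1 \<noteq> 0" "E2 \<noteq> 0"
    and "N = q * M"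
    and poly: "(X0 - q*w*u)*D0*D1*D2 =
      -(q*J*N*an*A2*s1*D0) - q*J*t1*bn*w*s0*D0 - q*J*N*t1*cn*A1*E9*s0*D2 + q^2*J*t1*dn*S9*D2"
    and S9: "S9 = (M - 1) * s9"
  shows "X0/(N*q*J) + (-(t1*w/N))*(u/(t1*J)) = an/(t1*E1*D1*D2)*(-(t1*A2*E1)*s1)
    + bn/(D1*D2)*(-(t1*w/N)*s0) + cn/(D0*D1)*(-(t1*A1*E9)*s0) + dn/(E2*D0*D1)*(-(t1*(1-M)*E2/M)*s9)"
proof -
  let ?K = "N*q*J*D0*D1*D2"
  have "an/(t1*E1*D1*D2)*(-(t1*A2*E1)*s1) = -(q*J*N*an*A2*s1*D0)/?K"
    "bn/(D1*D2)*(-(t1*w/N)*s0) = -(q*J*t1*bn*w*s0*D0)/?K"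
    "cn/(D0*D1)*(-(t1*A1*E9)*s0) = -(q*J*N*t1*cn*A1*E9*s0*D2)/?K"
    "dn/(E2*D0*D1)*(-(t1*(1-M)*E2/M)*s9) = q^2*J*t1*dn*S9*D2/?K"
    "X0/(N*q*J) + (-(t1*w/N))*(u/(t1*J)) = (X0 - q*w*u)*D0*D1*D2/?K"
    using assms(1-9) unfolding \<open>N = q * M\<close> S9 by (simp_all add: field_simps power2_eq_square)
  then show ?thesis
    by (simp only: poly add_divide_distrib diff_divide_distrib) simp
qed

section \<open>Comparison of coefficients\<close>

context askey_wilson
begin

text \<open>As \<open>z * z = z * (z + q / z) - q\<close>, the \<open>z\<close>-part of X in degree
  \<open>n\<close> contributes \<open>- q\<close> times itself to the part of the product without
  \<open>z\<close>, and \<open>z + q / z\<close> times itself to the \<open>z\<close>-part. This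
  gives the left sides.\<close>

lemma coefficient_identities:
  assumes "n \<ge> 1"
    and N: "N = q ^ n" and M: "M = q ^ (n - 1)" and J: "J = q ^ j" and x: "x = t1 * t2"
    and D0: "D0 = 1 - T*M^2" and D1: "D1 = 1 - T*M*N" and D2: "D2 = 1 - T*N^2"
    and E1: "E1 = 1 - e2*N" and E2: "E2 = 1 - x*M" and k: "k = -1 - x + T*M + x*N"
    and an: "an = (1-x*N)*(1-t1*e1*N+t1^2*e2*N^2)*k"
    and bn: "bn = N*k*(-e1+t2*e2*N+t1*e2*N)"
    and cn: "cn = -((1-N)*(1-x*N)*(-t1-t2+x*e1*M))"
    and dn: "dn = t1*(1-N)*(1-x*N)*(1-t2*e1*M+t2^2*e2*M^2)*(1-e2*M)"
    and w: "w = (1-N)*(1-x*N)"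
  shows "q*t1*w/N * s n j = an/(t1*E1*D1*D2) * rho (N*e2) (-(t1*(1-T*N))) (Suc n) j
      + bn/(D1*D2) * rho 1 (t1*x*(1-N)) n j
      + cn/(D0*D1) * rho (M*e2) (-(t1*(1-T*M))) n j
      + dn/(E2*D0*D1) * rho 1 (t1*x*(1-M)) (n-1) j" (is ?const)
    and "rho 1 (t1*x*(1-N)) n j + (-(t1*w/N)) * ((s n j*(1+t1^2*J^2*q) - q*prev (s n) j)/(t1*J)) =
      an/(t1*E1*D1*D2) * (-(t1*(1-T*N)*E1) * s (Suc n) j)
      + bn/(D1*D2) * (-(t1*w/N) * s n j)
      + cn/(D0*D1) * (-(t1*(1-T*M)*(1-e2*M)) * s n j)
      + dn/(E2*D0*D1) * (-(t1*(1-M)*E2/M) * s (n-1) j)" (is ?zpart)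
proof -
  have NM: "N = q * M" using assms by (cases n) auto
  have nz: "q \<noteq> 0" "t1 \<noteq> 0" "J \<noteq> 0" "M \<noteq> 0"
    using q_nonzero t1_nonzero by (auto simp: J M)
  have Tk: "1 - T * q ^ k \<noteq> 0" for k
    using t1234 by (simp add: T_def)
  have Dnz: "D0 \<noteq> 0" "D1 \<noteq> 0" "D2 \<noteq> 0"
    using Tk[of "2*(n-1)"] Tk[of "(n-1)+n"] Tk[of "2*n"]
    by (simp_all add: D0 D1 D2 N M power_mult power_add mult.commute[of 2] mult.assoc)
  have Enz: "E1 \<noteq> 0" "E2 \<noteq> 0"
    using t34[of n] t12[of "n-1"] by (simp_all add: E1 E2 e2_def N M x)
  have Txe: "T = x * e2" by (simp add: T_def x e2_def)
  have P: "P = (1-x)*(1-t1*e1+t1^2*e2)"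
    by (simp add: P_def x e1_def e2_def algebra_simps power2_eq_square)
  have iq: "inverse q ^ n = 1 / N" by (simp add: N power_inverse divide_inverse)
  have Nn: "q ^ Suc n = q * N" "q ^ n = N" "q ^ (n - 1) = M"
    by (simp_all add: N M)
  have h1: "h (Suc n) = (q*N-1)*(1-T*N)/(q*N)"
    using nz NM by (simp add: h_def iq Nn field_simps flip: N)
  have h0: "h n = (N-1)*(1-T*M)/N"
    using nz NM by (simp add: h_def iq Nn field_simps)
  have h9: "h (n-1) = (M-1)*(q-T*M)/(M*q)"
    unfolding h_def power_inverse M[symmetric] using nz by (simp add: field_simps)
  have "?const \<and> ?zpart"
  proof (cases j)
    case 0
    define b where "b = e2*(1+t1^2*q) - q*t1*e1"
    define y1 where "y1 = q*N*e2*P - e2*(q*N-1)*(1-T*N) - (1-T*N)*b"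
    define x0 where "x0 = q*N*P - q*(N-1)*(1-T*M) + N*x*(1-N)*b"
    define y0 where "y0 = N*e2*P - e2*(N-1)*(1-T*M) - (1-T*M)*b"
    define x9 where "x9 = N*P - (M-1)*(q-T*M) + M*x*(1-M)*b"
    have J1: "J = 1" using 0 by (simp add: J)
    have rhos: "rho (N*e2) (-(t1*(1-T*N))) (Suc n) j = y1/(q*J)"
      "rho 1 (t1*x*(1-N)) n j = x0/(N*q*J)"
      "rho (M*e2) (-(t1*(1-T*M))) n j = y0/(q*J)"
      "rho 1 (t1*x*(1-M)) (n-1) j = x9/(M*q*J)"
      unfolding rho_def h1 h0 h9 y1_def x0_def y0_def x9_def b_def 0 J1 NM using nz
      by (simp_all add: field_simps)
    have s: "s m j = 1" "prev (s m) j = 0" for m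
      by (simp_all add: 0)
    note poly = NM x Txe D0 D1 D2
    show ?thesis
      unfolding rhos s
    proof (intro conjI clear_denominators_const[OF nz Dnz Enz NM] clear_denominators_z[OF nz Dnz Enz NM _ refl])
      show "q^2*t1^2*J*w*1*D0*D1*D2*E1*E2 =
        N*an*y1*D0*E2 + t1*bn*x0*D0*E1*E2 + t1*N*cn*y0*D2*E1*E2 + t1*q*dn*x9*D2*E1"
        using const_part_poly_0[OF poly E1 E2 P k b_def y1_def x0_def y0_def x9_def]
        by (simp add: J1 w an bn cn dn power2_eq_square mult_ac)
      show "(x0 - q*w*(1*(1+t1^2*J^2*q) - q*0))*D0*D1*D2 =
        -(q*J*N*an*(1-T*N)*1*D0) - q*J*t1*bn*w*1*D0 - q*J*N*t1*cn*(1-T*M)*(1-e2*M)*1*D2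
        + q^2*J*t1*dn*((M-1)*1)*D2"
        using z_part_poly_0[OF poly P k b_def x0_def]
        by (simp add: J1 w an bn cn dn power2_eq_square mult_ac)
    qed
  next
    case (Suc i)
    define G where "G = (1 - x*J)*(1 - t1*e1*J + t1^2*e2*J^2)"
    define s1 where "s1 = q*(q*N-J)*(q-T*M*J)*(1-T*M*J)*(1-T*N*J)"
    define m1 where "m1 = q*N*G*(q-T*M*J)*(1-T*M*J)"
    define s0 where "s0 = q*(q*N-J)*(N-J)*(q-T*M*J)*(1-T*M*J)"
    define m0 where "m0 = N*G*(q*N-J)*(q-T*M*J)"
    define s9 where "s9 = q*(q*N-J)*(N-J)*(M-J)*(1-T*M)*(q-T*M*J)"
    define m9 where "m9 = q*M*G*(q*N-J)*(N-J)*(1-T*M)"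
    define br where "br = (\<lambda>s m. s*(e2*(1+t1^2*J^2*q) - q*t1*J*e1) - q*e2*(1-J)*m)"
    define y1 where "y1 = e2*(q*N-1)*(q*m1-s1) - br s1 m1"
    define x0 where "x0 = q*(1-T*M)*(q*m0-s0) - N*x*br s0 m0"
    define y0 where "y0 = e2*(N-1)*(q*m0-s0) - br s0 m0"
    define x9 where "x9 = (q-T*M)*(q*m9-s9) - M*x*br s9 m9"
    have G': "G = (1 - t1*t2*J) * (1 - t1*t3*J) * (1 - t1*t4*J)"
      by (simp add: G_def x e1_def e2_def algebra_simps power2_eq_square)
    obtain B where sv: "s (Suc n) j = B*(N-1)*s1" "prev (s (Suc n)) j = (1-J)*B*(N-1)*m1"
      "s n j = B*(1-T*N)*s0" "prev (s n) j = (1-J)*B*(1-T*N)*m0"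
      "(M-1)*s (n-1) j = B*(1-T*N)*s9" "(M-1)*prev (s (n-1)) j = (1-J)*B*(1-T*N)*m9"
      unfolding s1_def m1_def s0_def m0_def s9_def m9_def Suc prev_simps
      by (rule values_Suc[OF assms(1) N M J[unfolded Suc] G'])
    have J1: "1 - J \<noteq> 0" using q_power[of i] by (simp add: J Suc)
    have "P * r m j * (1 - J) = q * h m * prev (s m) j" for m
      using r_Suc[of m i] by (simp add: J Suc)
    \<comment> \<open>Division by \<open>1 - J\<close> is possible as \<open>j > 0\<close>, and it
      cancels against the factor \<open>1 - J\<close> of the preceding coefficients in
      \<open>sv\<close>.\<close>
    then have Pr: "P * r m j = q * h m * prev (s m) j / (1 - J)" for m
      using J1 by (simp add: field_simps)
    have r1: "P * r (Suc n) j = q * h (Suc n) * (B*(N-1)*m1)"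
      and r0: "P * r n j = q * h n * (B*(1-T*N)*m0)"
      unfolding Pr sv using J1 by (simp_all add: mult.assoc)
    have hs9: "h (n-1) * s (n-1) j = (q-T*M)/(M*q) * (B*(1-T*N)*s9)"
      unfolding h9 sv(5)[symmetric] by simp
    have "h (n-1) * prev (s (n-1)) j = (q-T*M)/(M*q) * ((1-J)*B*(1-T*N)*m9)"
      unfolding h9 sv(6)[symmetric] by simp
    then have r9: "P * r (n-1) j = (q-T*M)/M * (B*(1-T*N)*m9)"
      using Pr[of "n-1"] J1 nz by (simp add: mult.assoc)
    have rho1: "rho (N*e2) (-(t1*(1-T*N))) (Suc n) j = (1-T*N)*B*(N-1)*y1/(q*J)"
      unfolding rho_def J[symmetric] r1 h1 sv y1_def br_def using nz NM by (simp add: field_simps)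
    have rho0: "rho 1 (t1*x*(1-N)) n j = (N-1)*(1-T*N)*B*x0/(N*q*J)"
      unfolding rho_def J[symmetric] r0 h0 sv x0_def br_def using nz NM by (simp add: field_simps)
    have rho0': "rho (M*e2) (-(t1*(1-T*M))) n j = (1-T*M)*(1-T*N)*B*y0/(q*J)"
      unfolding rho_def J[symmetric] r0 h0 sv y0_def br_def using nz NM by (simp add: field_simps)
    \<comment> \<open>In degree \<open>n - 1\<close> both \<open>h\<close> and the coefficient of
      \<open>S\<close> contain \<open>M - 1\<close>. Attaching it to the series coefficients lets
      \<open>sv\<close> apply even if \<open>M = 1\<close>.\<close>
    have "rho 1 (t1*x*(1-M)) (n-1) j = (q*t1*(P * r (n-1) j - h (n-1) * s (n-1) j)
       - t1*x*(((M-1)*s (n-1) j) * (e2 * (1 + t1^2 * J^2 * q) - q * t1 * J * e1)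
            - q * e2 * ((M-1)*prev (s (n-1)) j))) / (q * t1 * J)"
      unfolding rho_def J[symmetric] by (simp add: algebra_simps)
    also have "\<dots> = (1-T*N)*B*x9/(M*q*J)"
      unfolding r9 hs9 sv x9_def br_def using nz by (simp add: field_simps)
    finally have rho9: "rho 1 (t1*x*(1-M)) (n-1) j = (1-T*N)*B*x9/(M*q*J)" .
    note poly = NM x Txe D0 D1 D2
    \<comment> \<open>A common factor of all terms in both identities; what it multiplies is the
      polynomial identity.\<close>
    let ?c = "(N-1)*(1-T*N)*B"
    show ?thesis
      unfolding rho1 rho0 rho0' rho9 sv(1-4)
    proof (intro conjI clear_denominators_const[OF nz Dnz Enz NM] clear_denominators_z[OF nz Dnz Enz NM _ sv(5)[symmetric]])
      show "q^2*t1^2*J*w*(B*(1-T*N)*s0)*D0*D1*D2*E1*E2 =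
        N*an*((1-T*N)*B*(N-1)*y1)*D0*E2 + t1*bn*((N-1)*(1-T*N)*B*x0)*D0*E1*E2
        + t1*N*cn*((1-T*M)*(1-T*N)*B*y0)*D2*E1*E2 + t1*q*dn*((1-T*N)*B*x9)*D2*E1" (is "?l = ?r")
      proof -
        have "?l = ?c * -(q^2*t1^2*J*(1-x*N)*s0*D0*D1*D2*E1*E2)"
          unfolding w by algebra
        also have "\<dots> = ?r"
          unfolding const_part_poly_Suc[OF poly E1 E2 G_def k s1_def m1_def s0_def m0_def s9_def m9_def
            br_def y1_def x0_def y0_def x9_def] an bn cn dn by algebra
        finally show ?thesis .
      qed
      show "((N-1)*(1-T*N)*B*x0 - q*w*(B*(1-T*N)*s0*(1+t1^2*J^2*q) - q*((1-J)*B*(1-T*N)*m0)))*D0*D1*D2 =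
        -(q*J*N*an*(1-T*N)*(B*(N-1)*s1)*D0) - q*J*t1*bn*w*(B*(1-T*N)*s0)*D0
        - q*J*N*t1*cn*(1-T*M)*(1-e2*M)*(B*(1-T*N)*s0)*D2
        + q^2*J*t1*dn*(B*(1-T*N)*s9)*D2" (is "?l = ?r")
      proof -
        have "?l = ?c * ((x0 + q*(1-x*N)*(s0*(1+t1^2*J^2*q) - q*(1-J)*m0))*D0*D1*D2)"
          unfolding w by algebra
        also have "\<dots> = ?r"
          unfolding z_part_poly_Suc[OF poly G_def k s1_def s0_def m0_def s9_def br_def x0_def]
            an bn cn dn w by algebra
        finally show ?thesis .
      qed
    qed
  qed
  then show ?const ?zpart by auto
qed

end

section \<open>Summation of the coefficient identities\<close>

context askey_wilson
begin

lemma recurrence: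
  assumes "n \<ge> 1"
    and N: "N = q ^ n" and M: "M = q ^ (n - 1)" and x: "x = t1 * t2"
    and D0: "D0 = 1 - T*M^2" and D1: "D1 = 1 - T*M*N" and D2: "D2 = 1 - T*N^2"
    and E1: "E1 = 1 - e2*N" and E2: "E2 = 1 - x*M" and k: "k = -1 - x + T*M + x*N"
    and an: "an = (1-x*N)*(1-t1*e1*N+t1^2*e2*N^2)*k"
    and bn: "bn = N*k*(-e1+t2*e2*N+t1*e2*N)"
    and cn: "cn = -((1-N)*(1-x*N)*(-t1-t2+x*e1*M))"
    and dn: "dn = t1*(1-N)*(1-x*N)*(1-t2*e1*M+t2^2*e2*M^2)*(1-e2*M)"
  shows "z * (1 * P * R n + t1*x*(1-N) * S n) =
    an/(t1*E1*D1*D2) * (N*e2 * P * R (Suc n) + (-(t1*(1-T*N))) * S (Suc n))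
    + bn/(D1*D2) * (1 * P * R n + t1*x*(1-N) * S n)
    + cn/(D0*D1) * (M*e2 * P * R n + (-(t1*(1-T*M))) * S n)
    + dn/(E2*D0*D1) * (1 * P * R (n-1) + t1*x*(1-M) * S (n-1))"
proof -
  \<comment> \<open>One truncation for all three degrees: \<open>Suc n\<close> reaches the last
    summand of \<open>R (Suc n)\<close>.\<close>
  define L where "L = Suc n"
  define w where "w = (1-N)*(1-x*N)"
  define C where "C = -(t1*w/N)"
  define \<Phi> where "\<Phi> m = (\<Sum>j\<le>L. s m j * W j)" for m
  define X where "X \<mu> \<nu> m = (\<Sum>j\<le>L. rho \<mu> \<nu> m j * W j)" for \<mu> \<nu> m
  have NM: "N = q * M" using assms by (cases n) auto
  have nz: "q \<noteq> 0" "t1 \<noteq> 0" "M \<noteq> 0" "N \<noteq> 0"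
    using q_nonzero t1_nonzero by (auto simp: M N)
  have Txe: "T = x * e2" by (simp add: T_def x e2_def)
  have iq: "inverse q ^ n = 1 / N" "q ^ n = N" by (simp_all add: N power_inverse divide_inverse)
  have Cn: "1 * t1 * h n + t1*x*(1-N) * (1 - e2/q) = C"
    using nz by (simp add: h_def iq C_def w_def Txe field_simps)
  have CY: "M*e2 * t1 * h n + (-(t1*(1-T*M))) * (1 - e2/q) = -(t1*(1-T*M)*(1-e2*M))"
    using nz by (simp add: h_def iq Txe NM field_simps)
  have CY': "N*e2 * t1 * h (Suc n) + (-(t1*(1-T*N))) * (1 - e2/q) = -(t1*(1-T*N)*E1)"
    using nz by (simp add: h_def iq E1 Txe field_simps)
  have expand: "\<mu> * P * R m + \<nu> * S m = X \<mu> \<nu> m + z * (\<mu> * t1 * h m + \<nu> * (1 - e2/q)) * \<Phi> m"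
    if "1 \<le> m" "m \<le> L" for \<mu> \<nu> m
    using rho_expansion[OF that] phi_eq[OF that] by (simp add: X_def \<Phi>_def)
  have Xn: "1 * P * R n + t1*x*(1-N) * S n = X 1 (t1*x*(1-N)) n + z * C * \<Phi> n"
    and Yn: "M*e2 * P * R n + (-(t1*(1-T*M))) * S n = X (M*e2) (-(t1*(1-T*M))) n + z * -(t1*(1-T*M)*(1-e2*M)) * \<Phi> n"
    and Yn': "N*e2 * P * R (Suc n) + (-(t1*(1-T*N))) * S (Suc n) = X (N*e2) (-(t1*(1-T*N))) (Suc n) + z * -(t1*(1-T*N)*E1) * \<Phi> (Suc n)"
    unfolding Cn[symmetric] CY[symmetric] CY'[symmetric]
    by (rule expand; use assms(1) in \<open>simp add: L_def\<close>)+
  have Xn': "1 * P * R (n-1) + t1*x*(1-M) * S (n-1) = X 1 (t1*x*(1-M)) (n-1) + z * -(t1*(1-M)*E2/M) * \<Phi> (n-1)"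
  proof (cases "n = 1")
    \<comment> \<open>Here \<open>M = 1\<close>, so the coefficients of \<open>S 0\<close> and
      \<open>\<Phi> 0\<close> both vanish.\<close>
    case True
    then have "M = 1" by (simp add: M)
    then show ?thesis using rho_expansion_0[of 1 L] True by (simp add: X_def)
  next
    case False
    have "1 * t1 * h (n-1) + t1*x*(1-M) * (1 - e2/q) = -(t1*(1-M)*E2/M)"
      using nz unfolding h_def power_inverse M[symmetric] by (simp add: E2 Txe field_simps)
    then show ?thesis
      using expand[of "n-1" 1 "t1*x*(1-M)"] False assms(1) by (simp add: L_def)
  qed
  have "s n L = 0"
    using assms(1) by (simp add: L_def s_eq_0)
  then have sigma: "\<Phi> n * (z + q / z) = (\<Sum>j\<le>L. (s n j * (1 + t1\<^sup>2 * (q^j)\<^sup>2 * q) - q * prev (s n) j) / (t1 * q ^ j) * W j)"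
    unfolding \<Phi>_def sum_s_sigma_W by simp
  note ids = coefficient_identities[OF assms(1) N M refl x D0 D1 D2 E1 E2 k an bn cn dn w_def]
  have const: "- (q * C * \<Phi> n) = an/(t1*E1*D1*D2) * X (N*e2) (-(t1*(1-T*N))) (Suc n)
      + bn/(D1*D2) * X 1 (t1*x*(1-N)) n + cn/(D0*D1) * X (M*e2) (-(t1*(1-T*M))) n
      + dn/(E2*D0*D1) * X 1 (t1*x*(1-M)) (n-1)"
  proof -
    have "- (q * C * \<Phi> n) = (\<Sum>j\<le>L. (q*t1*w/N * s n j) * W j)"
      by (simp add: C_def \<Phi>_def sum_distrib_left mult_ac flip: sum_negf)
    also have "\<dots> = an/(t1*E1*D1*D2) * X (N*e2) (-(t1*(1-T*N))) (Suc n)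
      + bn/(D1*D2) * X 1 (t1*x*(1-N)) n + cn/(D0*D1) * X (M*e2) (-(t1*(1-T*M))) n
      + dn/(E2*D0*D1) * X 1 (t1*x*(1-M)) (n-1)"
      unfolding ids(1) X_def sum_distrib_left distrib_right sum.distrib by (simp only: mult.assoc)
    finally show ?thesis .
  qed
  have zpart: "X 1 (t1*x*(1-N)) n + C * (\<Phi> n * (z + q/z)) = an/(t1*E1*D1*D2) * (-(t1*(1-T*N)*E1) * \<Phi> (Suc n))
      + bn/(D1*D2) * (C * \<Phi> n) + cn/(D0*D1) * (-(t1*(1-T*M)*(1-e2*M)) * \<Phi> n)
      + dn/(E2*D0*D1) * (-(t1*(1-M)*E2/M) * \<Phi> (n-1))"
  proof -
    have "X 1 (t1*x*(1-N)) n + C * (\<Phi> n * (z + q/z)) = (\<Sum>j\<le>L. (rho 1 (t1*x*(1-N)) n j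
       + C * ((s n j * (1 + t1\<^sup>2 * (q^j)\<^sup>2 * q) - q * prev (s n) j) / (t1 * q ^ j))) * W j)"
      unfolding sigma X_def sum_distrib_left distrib_right sum.distrib by (simp only: mult.assoc)
    also have "\<dots> = an/(t1*E1*D1*D2) * (-(t1*(1-T*N)*E1) * \<Phi> (Suc n))
      + bn/(D1*D2) * (C * \<Phi> n) + cn/(D0*D1) * (-(t1*(1-T*M)*(1-e2*M)) * \<Phi> n)
      + dn/(E2*D0*D1) * (-(t1*(1-M)*E2/M) * \<Phi> (n-1))"
      unfolding ids(2)[folded C_def] \<Phi>_def sum_distrib_left distrib_right sum.distrib by (simp only: mult.assoc)
    finally show ?thesis .
  qed
  \<comment> \<open>The square of \<open>z\<close> is replaced by
    \<open>z * (z + q / z) - q\<close>, which separates the two parts again.\<close>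
  have "z * (X 1 (t1*x*(1-N)) n + z * C * \<Phi> n) =
     z * (X 1 (t1*x*(1-N)) n + C * (\<Phi> n * (z + q/z))) - q * C * \<Phi> n"
    using z_nonzero by (simp add: field_simps)
  also have "\<dots> = z * (X 1 (t1*x*(1-N)) n + C * (\<Phi> n * (z + q/z))) + - (q * C * \<Phi> n)"
    by simp
  finally show ?thesis
    unfolding Xn Yn Yn' Xn' zpart const by (simp only: distrib_left mult_ac add_ac)
qed

end

section \<open>Specialization to the real parameters\<close>

lemma one_minus_prod_power_nonzero:
  fixes q a b :: real
  assumes "\<bar>a\<bar> < 1" "\<bar>b\<bar> \<le> 1" "0 < q" "q < 1"
  shows "1 - of_real a * of_real b * of_real q ^ k \<noteq> (0 :: complex)"
proof -
  have "\<bar>b * q ^ k\<bar> \<le> 1"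
    using assms by (simp add: abs_mult mult_le_one power_le_one)
  then have "\<bar>a * (b * q ^ k)\<bar> < 1"
    unfolding abs_mult[of a] using assms(1) by (meson abs_ge_zero le_less_trans mult_left_le)
  then have "1 - a * b * q ^ k \<noteq> 0"
    by (auto simp: mult.assoc)
  then have "complex_of_real (1 - a * b * q ^ k) \<noteq> 0"
    by (simp only: of_real_eq_0_iff not_False_eq_True)
  then show ?thesis by simp
qed

theorem proposition4p10:
  fixes q t1 t2 t3 t4 :: real and n :: nat
  assumes "0 < q" and "q < 1"
    and "\<bar>t1\<bar> < 1" and "\<bar>t2\<bar> < 1" and "\<bar>t3\<bar> < 1" and "\<bar>t4\<bar> < 1"
    and "n \<ge> 1" and "t1 \<noteq> 0"
  shows "let
    a = (1 - t1 * t2 * q ^ n) * (1 - t1 * t3 * q ^ n) * (1 - t1 * t4 * q ^ n) *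
          (- 1 - t1 * t2 + t1 * t2 * t3 * t4 * q ^ (n - 1) + t1 * t2 * q ^ n) /
        (t1 * (1 - t3 * t4 * q ^ n) * (1 - t1 * t2 * t3 * t4 * q ^ (2 * n - 1)) *
          (1 - t1 * t2 * t3 * t4 * q ^ (2 * n)));
    b = q ^ n * (- 1 - t1 * t2 + t1 * t2 * t3 * t4 * q ^ (n - 1) + t1 * t2 * q ^ n) *
          (- t3 - t4 + t2 * t3 * t4 * q ^ n + t1 * t3 * t4 * q ^ n) /
        ((1 - t1 * t2 * t3 * t4 * q ^ (2 * n - 1)) * (1 - t1 * t2 * t3 * t4 * q ^ (2 * n)));
    c = - ((1 - q ^ n) * (1 - t1 * t2 * q ^ n) *
            (- t1 - t2 + t1 * t2 * (t3 + t4) * q ^ (n - 1)) /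
          ((1 - t1 * t2 * t3 * t4 * q ^ (2 * n - 2)) * (1 - t1 * t2 * t3 * t4 * q ^ (2 * n - 1))));
    d = t1 * (1 - q ^ n) * (1 - t1 * t2 * q ^ n) * (1 - t2 * t3 * q ^ (n - 1)) *
          (1 - t2 * t4 * q ^ (n - 1)) * (1 - t3 * t4 * q ^ (n - 1)) /
        ((1 - t1 * t2 * q ^ (n - 1)) * (1 - t1 * t2 * t3 * t4 * q ^ (2 * n - 2)) *
          (1 - t1 * t2 * t3 * t4 * q ^ (2 * n - 1)))
    in \<forall>z::complex. z \<noteq> 0 \<longrightarrow>
      z * AW_X q t1 t2 t3 t4 n z =
        of_real a * AW_Y q t1 t2 t3 t4 (- int n - 1) z +
        of_real b * AW_X q t1 t2 t3 t4 n z +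
        of_real c * AW_Y q t1 t2 t3 t4 (- int n) z +
        of_real d * AW_X q t1 t2 t3 t4 (n - 1) z"
  unfolding Let_def
proof (intro allI impI)
  fix z :: complex
  assume z: "z \<noteq> 0"
  let ?q = "complex_of_real q" and ?t1 = "complex_of_real t1" and ?t2 = "complex_of_real t2"
    and ?t3 = "complex_of_real t3" and ?t4 = "complex_of_real t4"
  have le: "\<bar>t2\<bar> \<le> 1" "\<bar>t3\<bar> \<le> 1" "\<bar>t4\<bar> \<le> 1" "\<bar>t2 * t3 * t4\<bar> \<le> 1"
    using assms by (simp_all add: abs_mult mult_le_one)
  interpret askey_wilson ?q ?t1 ?t2 ?t3 ?t4 z
  proof
    show "1 - ?q ^ Suc k \<noteq> 0" for k
      using one_minus_prod_power_nonzero[of q 1 q k] assms by simp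
    show "1 - ?t1 * ?t2 * ?t3 * ?t4 * ?q ^ k \<noteq> 0" for k
      using one_minus_prod_power_nonzero[OF assms(3) le(4) assms(1,2)] by (simp add: mult.assoc)
  qed (use z assms le one_minus_prod_power_nonzero in auto)
  have AW_R: "AW_R q t1 t2 t3 t4 m z = R m" for m
  proof -
    have "complex_of_real (q powi (- int m)) = inverse ?q ^ m"
      by (simp add: power_int_minus power_inverse)
    moreover have "complex_of_real (t1 * t2 * t3 * t4 * q powi (int m - 1)) = T * ?q ^ m / ?q"
      using assms by (simp add: T_def power_int_diff)
    ultimately show ?thesis
      unfolding AW_R_def phi43_def R_def r_def U_def by (simp add: mult_ac)
  qed
  have AW_S: "AW_S q t1 t2 t3 t4 m z = S m" if "m \<noteq> 0" for m
  proof -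
    have q: "complex_of_real (q powi (1 - int m)) = ?q * inverse ?q ^ m"
      using assms by (simp add: power_int_diff power_inverse divide_inverse)
    have T: "complex_of_real (t1 * t2 * t3 * t4 * q ^ m) = T * ?q ^ m"
      by (simp add: T_def)
    have "z * (1 - ?t3 / z) * (1 - ?t4 / z) = z - e1 + e2 / z"
      using z by (simp add: e1_def e2_def field_simps)
    then show ?thesis
      unfolding AW_S_def phi43_def S_def \<phi>_def s_def d_def W_def q T using that by (simp add: mult_ac)
  qed
  \<comment> \<open>At \<open>m = 0\<close>, \<open>AW_S\<close> is 0 by convention while
    \<open>S 0\<close> need not be; the factor \<open>1 - ?q ^ 0\<close> makes both contributions
    vanish.\<close>
  have X: "AW_X q t1 t2 t3 t4 m z = 1 * P * R m + ?t1 * (?t1 * ?t2) * (1 - ?q ^ m) * S m" for m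
    by (cases "m = 0") (simp_all add: AW_X_def AW_R AW_S P_def power2_eq_square)
  have Y: "AW_Y q t1 t2 t3 t4 (- int m) z =
      (?q ^ (m - 1) * e2) * P * R m + (- (?t1 * (1 - T * ?q ^ (m - 1)))) * S m" if "m \<noteq> 0" for m
    using that by (simp add: AW_Y_def Let_def AW_R AW_S P_def T_def e2_def mult_ac)
  have Y': "AW_Y q t1 t2 t3 t4 (- int n - 1) z =
      (?q ^ n * e2) * P * R (Suc n) + (- (?t1 * (1 - T * ?q ^ n))) * S (Suc n)"
  proof -
    have "- int n - 1 = - int (Suc n)" by simp
    then show ?thesis using Y[of "Suc n"] by (simp only: diff_Suc_1)
  qed
  \<comment> \<open>The subtractions of natural numbers are exact because \<open>n\<close> is at
    least 1.\<close>
  have pw: "?q ^ (2 * n - 1) = ?q ^ (n - 1) * ?q ^ n" "?q ^ (2 * n) = (?q ^ n)\<^sup>2"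
    "?q ^ (2 * n - 2) = (?q ^ (n - 1))\<^sup>2"
    using assms(7) by (simp_all flip: power_add power_mult add: mult_2 mult.commute[of _ 2] right_diff_distrib')
  have n0: "n \<noteq> 0" using assms(7) by simp
  note coeff = T_def e1_def e2_def pw of_real_add of_real_diff of_real_mult of_real_divide of_real_minus of_real_power of_real_1
  show "z * AW_X q t1 t2 t3 t4 n z =
        of_real ((1 - t1 * t2 * q ^ n) * (1 - t1 * t3 * q ^ n) * (1 - t1 * t4 * q ^ n) *
          (- 1 - t1 * t2 + t1 * t2 * t3 * t4 * q ^ (n - 1) + t1 * t2 * q ^ n) /
        (t1 * (1 - t3 * t4 * q ^ n) * (1 - t1 * t2 * t3 * t4 * q ^ (2 * n - 1)) *
          (1 - t1 * t2 * t3 * t4 * q ^ (2 * n)))) * AW_Y q t1 t2 t3 t4 (- int n - 1) z +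
        of_real (q ^ n * (- 1 - t1 * t2 + t1 * t2 * t3 * t4 * q ^ (n - 1) + t1 * t2 * q ^ n) *
          (- t3 - t4 + t2 * t3 * t4 * q ^ n + t1 * t3 * t4 * q ^ n) /
        ((1 - t1 * t2 * t3 * t4 * q ^ (2 * n - 1)) * (1 - t1 * t2 * t3 * t4 * q ^ (2 * n)))) * AW_X q t1 t2 t3 t4 n z +
        of_real (- ((1 - q ^ n) * (1 - t1 * t2 * q ^ n) *
            (- t1 - t2 + t1 * t2 * (t3 + t4) * q ^ (n - 1)) /
          ((1 - t1 * t2 * t3 * t4 * q ^ (2 * n - 2)) * (1 - t1 * t2 * t3 * t4 * q ^ (2 * n - 1))))) * AW_Y q t1 t2 t3 t4 (- int n) z +
        of_real (t1 * (1 - q ^ n) * (1 - t1 * t2 * q ^ n) * (1 - t2 * t3 * q ^ (n - 1)) *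
          (1 - t2 * t4 * q ^ (n - 1)) * (1 - t3 * t4 * q ^ (n - 1)) /
        ((1 - t1 * t2 * q ^ (n - 1)) * (1 - t1 * t2 * t3 * t4 * q ^ (2 * n - 2)) *
          (1 - t1 * t2 * t3 * t4 * q ^ (2 * n - 1)))) * AW_X q t1 t2 t3 t4 (n - 1) z"
    (is "_ = ?a * _ + ?b * _ + ?c * _ + ?d * _")
  proof -
    define N where "N = ?q ^ n"
    define M where "M = ?q ^ (n - 1)"
    define x where "x = ?t1 * ?t2"
    define D0 where "D0 = 1 - T*M^2"
    define D1 where "D1 = 1 - T*M*N"
    define D2 where "D2 = 1 - T*N^2"
    define E1 where "E1 = 1 - e2*N"
    define E2 where "E2 = 1 - x*M"
    define k where "k = -1 - x + T*M + x*N"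
    note defs = D0_def D1_def D2_def E1_def E2_def k_def x_def N_def M_def
    have e: "1-?t1*e1*N+?t1^2*e2*N^2 = (1 - ?t1 * ?t3 * N) * (1 - ?t1 * ?t4 * N)"
      "1-?t2*e1*M+?t2^2*e2*M^2 = (1 - ?t2 * ?t3 * M) * (1 - ?t2 * ?t4 * M)"
      "-e1+?t2*e2*N+?t1*e2*N = - ?t3 - ?t4 + ?t2 * ?t3 * ?t4 * N + ?t1 * ?t3 * ?t4 * N"
      by (simp_all add: e1_def e2_def algebra_simps power2_eq_square)
    have a: "?a = (1-x*N)*(1-?t1*e1*N+?t1^2*e2*N^2)*k / (?t1*E1*D1*D2)"
      unfolding e unfolding defs by (simp only: coeff) (simp only: mult_ac)
    have b: "?b = N*k*(-e1+?t2*e2*N+?t1*e2*N) / (D1*D2)"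
      unfolding e unfolding defs by (simp only: coeff) (simp only: mult_ac)
    have c: "?c = -((1-N)*(1-x*N)*(-?t1-?t2+x*e1*M)) / (D0*D1)"
      unfolding defs by (simp only: coeff) (simp only: mult_ac minus_divide_left)
    have d: "?d = ?t1*(1-N)*(1-x*N)*(1-?t2*e1*M+?t2^2*e2*M^2)*(1-e2*M) / (E2*D0*D1)"
      unfolding e unfolding defs by (simp only: coeff) (simp only: mult_ac)
    show ?thesis
      unfolding a b c d X Y' Y[of n, OF n0] x_def[symmetric] N_def[symmetric] M_def[symmetric]
      by (rule recurrence[OF assms(7) N_def M_def x_def D0_def D1_def D2_def E1_def E2_def k_def refl refl refl refl])
  qed
qed

end
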